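(* $$A^{(2)}(x_1,x_2,x_3,\dots)=1+\frac{x_1^2(1-x_2+x_2A^{(2)}(x_1,x_2x_3,x_3x_4,\dots))}{1-x_1^2x_2(1-x_2x_3+x_2x_3A^{(2)}(x_1,x_2x_3^2x_4,x_3x_4^2x_5,\dots))},$$ and $$B^{(2)}(x_1,x_2,x_3,\dots)=x_1-x_1x_2+x_1x_2A^{(2)}(x_1,x_2x_3,x_3x_4\dots).$$
   Context: A permutation $\pi$ is a Dumont permutation (of the first kind) if each even integer in $\pi$ is followed by a smaller integer, and each odd integer is either followed by a larger integer or is the last element of $\pi$. Let $\mathcal{D}$ be the set of Dumont permutations of all sizes (including the empty one) avoiding $1\mbox{-}3\mbox{-}2$. Generalized patterns: letters separated by dashes may be at any distance, adjacent letters (as $12$ in $12\mbox{-}3\mbox{-}\cdots\mbox{-}j$) must be adjacent in $\pi$. For a pattern $\tau$, $\tau(\pi)$ is its number of occurrences in $\pi$; $1(\pi)$ is the length of $\pi$. Define $\mathcal{B}(x_1,x_2,\dots)=\sum_{\pi\in\mathcal{D}}x_1^{1(\pi)}\prod_{j\geq2}x_j^{12\mbox{-}3\mbox{-}\dots\mbox{-} j(\pi)}$, $A^{(2)}(x_1,x_2,\dots)=\frac12(\mathcal{B}(x_1,x_2,\dots)+\mathcal{B}(-x_1,x_2,\dots))$, $B^{(2)}(x_1,x_2,\dots)=\frac12(\mathcal{B}(x_1,x_2,\dots)-\mathcal{B}(-x_1,x_2,\dots))$. *)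

theory Defs
  imports
    "HOL-Combinatorics.Multiset_Permutations"
    "HOL-Computational_Algebra.Formal_Power_Series"
    "HOL-Computational_Algebra.Fraction_Field"
    "HOL-Library.Poly_Mapping"
begin

definition dumont :: "nat list \<Rightarrow> bool" where
  "dumont \<pi> \<longleftrightarrow>
     (\<forall>i < length \<pi>.
        (even (\<pi> ! i) \<longrightarrow> i + 1 < length \<pi> \<and> \<pi> ! (i + 1) < \<pi> ! i) \<and>
        (odd (\<pi> ! i) \<longrightarrow> i + 1 = length \<pi> \<or> \<pi> ! (i + 1) > \<pi> ! i))"

text \<open>
  A generalized pattern is a word \<open>w\<close> together with the set \<open>adj\<close> of (0-based) positions \<open>a\<close>
  such that there is no dash between the letters \<open>w ! a\<close> and \<open>w ! (a + 1)\<close>.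
  An occurrence is identified with the increasing list of positions that it occupies.
\<close>

type_synonym gen_pattern = "nat list \<times> nat set"

definition occurrences :: "gen_pattern \<Rightarrow> nat list \<Rightarrow> nat list set" where
  "occurrences = (\<lambda>(w, adj) \<pi>.
     {ps. length ps = length w \<and> sorted_wrt (<) ps \<and> set ps \<subseteq> {..<length \<pi>} \<and>
          (\<forall>a\<in>adj. ps ! (a + 1) = ps ! a + 1) \<and>
          (\<forall>a < length w. \<forall>b < length w. \<pi> ! (ps ! a) < \<pi> ! (ps ! b) \<longleftrightarrow> w ! a < w ! b)})"

definition occ :: "gen_pattern \<Rightarrow> nat list \<Rightarrow> nat" where
  "occ p \<pi> = card (occurrences p \<pi>)"

definition avoids :: "nat list \<Rightarrow> gen_pattern \<Rightarrow> bool" where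
  "avoids \<pi> p \<longleftrightarrow> occurrences p \<pi> = {}"

text \<open>The pattern 1-3-2, and the pattern 12-3-\<open>\<dots>\<close>-\<open>j\<close> for \<open>j \<ge> 2\<close>.\<close>

definition pat_132 :: gen_pattern where
  "pat_132 = ([1, 3, 2], {})"

definition pat_inc :: "nat \<Rightarrow> gen_pattern" where
  "pat_inc j = ([1..<j + 1], {0})"

lemma occ_eq_0:
  assumes "length (fst p) > length \<pi>"
  shows "occ p \<pi> = 0"
proof -
  have False if "ps \<in> occurrences p \<pi>" for ps
  proof -
    have ps: "length ps = length (fst p)" "sorted_wrt (<) ps" "set ps \<subseteq> {..<length \<pi>}"
      using that by (auto simp: occurrences_def split: prod.splits)
    then have "length ps = card (set ps)"
      by (simp add: distinct_card strict_sorted_iff)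
    also have "\<dots> \<le> length \<pi>"
      using card_mono[OF _ ps(3)] by simp
    finally show False using assms ps(1) by simp
  qed
  then have "occurrences p \<pi> = {}" by blast
  then show ?thesis by (simp add: occ_def)
qed

definition Dumont132 :: "nat list set" where
  "Dumont132 = {\<pi>. (\<exists>n. \<pi> \<in> permutations_of_set {1..n}) \<and> dumont \<pi> \<and> avoids \<pi> pat_132}"

text \<open>
  The generating functions are formal power series in \<open>x\<^sub>1\<close> (which is \<^const>\<open>fps_X\<close>); the
  remaining arguments \<open>x\<^sub>2, x\<^sub>3, \<dots>\<close> are the values \<open>x 2, x 3, \<dots>\<close> of a sequence of coefficients
  (the values \<open>x 0\<close> and \<open>x 1\<close> are not used).
  By \<open>occ_eq_0\<close>, all factors of the product with \<open>j\<close> greater than the length of \<open>\<pi>\<close> are 1.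
\<close>

definition B_gf :: "(nat \<Rightarrow> 'a::field) \<Rightarrow> 'a fps" where
  "B_gf x = Abs_fps (\<lambda>n. \<Sum>\<pi> | \<pi> \<in> Dumont132 \<and> length \<pi> = n.
                            \<Prod>j = 2..length \<pi>. x j ^ occ (pat_inc j) \<pi>)"

definition A2 :: "(nat \<Rightarrow> 'a::field) \<Rightarrow> 'a fps" where
  "A2 x = fps_const (1 / 2) * (B_gf x + fps_compose (B_gf x) (- fps_X))"

definition B2 :: "(nat \<Rightarrow> 'a::field) \<Rightarrow> 'a fps" where
  "B2 x = fps_const (1 / 2) * (B_gf x - fps_compose (B_gf x) (- fps_X))"

text \<open>
  The field of rational functions over the rationals in the indeterminates \<open>x\<^sub>j\<close>: a monomial is a
  finitely supported map from indices to exponents, a polynomial is a finitely supported map from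
  monomials to coefficients.
\<close>

type_synonym ratfun = "((nat \<Rightarrow>\<^sub>0 nat) \<Rightarrow>\<^sub>0 rat) fract"

definition indet :: "nat \<Rightarrow> ratfun" where
  "indet j = Fract (Poly_Mapping.single (Poly_Mapping.single j 1) 1) 1"

end

theory Submission
  imports Defs
begin

text \<open>
  Cut a Dumont permutation avoiding 1-3-2 at its maximum: it is \<open>(\<alpha> \<oplus> 1) \<ominus> \<beta>\<close>, that is, every
  entry up to the maximum lies above every entry of \<open>\<beta>\<close>. Conversely such a permutation is Dumont
  and avoids 1-3-2 iff \<open>\<alpha>\<close> and \<open>\<beta>\<close> do and, for \<open>a = |\<alpha>|\<close> and \<open>k = |\<beta>|\<close>, either \<open>k = 0\<close> and \<open>a\<close>
  is even, or \<open>a = 0\<close> and \<open>k\<close> is odd, or \<open>a\<close> is odd and \<open>k > 0\<close> is even: if \<open>k\<close> were odd, the least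
  entry \<open>k + 1\<close> before the maximum would be even, and nothing there could follow it.

  A pattern that is not itself a skew sum never straddles \<open>\<ominus>\<close>, so the weight is multiplicative, and
  \<open>\<oplus> 1\<close> on a nonempty \<open>\<alpha>\<close> multiplies it by \<open>x\<^sub>2\<close> and replaces each \<open>x\<^sub>j\<close> by \<open>y\<^sub>j = x\<^sub>j x\<^sub>j\<^sub>+\<^sub>1\<close>.
  For the even part \<open>A\<close> and the odd part \<open>B\<close> of the generating function this gives
  \<open>B(x) = x\<^sub>1 (1 - x\<^sub>2 + x\<^sub>2 A(y))\<close> and \<open>A(x) = 1 + x\<^sub>1 (B(x) + x\<^sub>2 (A(x) - 1) B(y))\<close>; the latter
  is linear in \<open>A(x)\<close>.
\<close>

section \<open>Order isomorphism of words\<close>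

definition dominates :: "'a::linorder list \<Rightarrow> 'a list \<Rightarrow> bool" where
  "dominates us vs \<longleftrightarrow> (\<forall>a\<in>set us. \<forall>b\<in>set vs. b < a)"

definition order_iso :: "'a::linorder list \<Rightarrow> 'b::linorder list \<Rightarrow> bool" where
  "order_iso us vs \<longleftrightarrow> length us = length vs \<and>
     (\<forall>i<length us. \<forall>j<length us. us ! i < us ! j \<longleftrightarrow> vs ! i < vs ! j)"

lemma order_iso_imp_length_eq: "order_iso us vs \<Longrightarrow> length us = length vs"
  by (simp add: order_iso_def)

lemma order_iso_map_strict_mono:
  "strict_mono f \<Longrightarrow> order_iso (map f us) vs \<longleftrightarrow> order_iso us vs"
  by (auto simp: order_iso_def strict_mono_less)

lemma order_iso_append_dominates_iff:
  assumes iso: "order_iso (us @ us') (vs @ vs')" and length: "length us = length vs"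
  shows "dominates us us' \<longleftrightarrow> dominates vs vs'"
proof -
  have "length us' = length vs'"
    using iso length by (simp add: order_iso_def)
  moreover have "us' ! j < us ! i \<longleftrightarrow> vs' ! j < vs ! i"
    if "i < length us" "j < length us'" for i j
  proof -
    have "(us @ us') ! (length us + j) < (us @ us') ! i \<longleftrightarrow>
        (vs @ vs') ! (length us + j) < (vs @ vs') ! i"
      using iso that unfolding order_iso_def by (simp del: nth_append_length_plus)
    then show ?thesis
      using that length by (simp add: nth_append)
  qed
  ultimately show ?thesis
    using length by (simp add: dominates_def all_set_conv_all_nth)
qed

lemma order_iso_snoc_max:
  assumes "\<forall>a\<in>set us. a < m"
  shows "order_iso (us @ [m]) (vs @ [l]) \<longleftrightarrow> order_iso us vs \<and> (\<forall>b\<in>set vs. b < l)"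
proof (cases "length us = length vs")
  case True
  have "us ! i < m \<and> \<not> m < us ! i" if "i < length vs" for i
    using assms that True by (simp add: less_not_sym)
  then have below_max: "(us ! i < m \<longleftrightarrow> vs ! i < l) \<and> (m < us ! i \<longleftrightarrow> l < vs ! i) \<longleftrightarrow> vs ! i < l"
    if "i < length vs" for i
    using that less_not_sym by blast
  have "order_iso (us @ [m]) (vs @ [l]) \<longleftrightarrow> order_iso us vs \<and>
      (\<forall>i<length vs. (us ! i < m \<longleftrightarrow> vs ! i < l) \<and> (m < us ! i \<longleftrightarrow> l < vs ! i))"
    using True by (simp add: order_iso_def All_less_Suc nth_append) blast
  also have "\<dots> \<longleftrightarrow> order_iso us vs \<and> (\<forall>b\<in>set vs. b < l)"
    using below_max by (auto simp: all_set_conv_all_nth)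
  finally show ?thesis .
qed (simp add: order_iso_def)

section \<open>Occurrences of generalized patterns\<close>

definition wf_pattern :: "gen_pattern \<Rightarrow> bool" where
  "wf_pattern = (\<lambda>(w, adj). \<forall>a\<in>adj. a + 1 < length w)"

lemma wf_pattern_pat_132 [simp]: "wf_pattern pat_132"
  by (simp add: wf_pattern_def pat_132_def)

lemma wf_pattern_pat_inc [simp]: "j \<ge> 2 \<Longrightarrow> wf_pattern (pat_inc j)"
  by (simp add: wf_pattern_def pat_inc_def del: upt_Suc)

lemma mem_occurrences_iff:
  "ps \<in> occurrences (w, adj) \<pi> \<longleftrightarrow>
     sorted_wrt (<) ps \<and> set ps \<subseteq> {..<length \<pi>} \<and> (\<forall>a\<in>adj. ps ! (a + 1) = ps ! a + 1) \<and>
     order_iso (map ((!) \<pi>) ps) w"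
  by (auto simp: occurrences_def order_iso_def)

lemma length_occurrence: "ps \<in> occurrences p \<pi> \<Longrightarrow> length ps = length (fst p)"
  by (auto simp: occurrences_def split: prod.splits)

lemma set_occurrence_subset: "ps \<in> occurrences p \<pi> \<Longrightarrow> set ps \<subseteq> {..<length \<pi>}"
  by (auto simp: occurrences_def split: prod.splits)

lemma finite_occurrences [simp]: "finite (occurrences p \<pi>)"
proof (rule finite_subset)
  show "occurrences p \<pi> \<subseteq> {ps. set ps \<subseteq> {..<length \<pi>} \<and> length ps = length (fst p)}"
    using length_occurrence set_occurrence_subset by blast
qed (rule finite_lists_length_eq, simp)

lemma occurrences_map_strict_mono:
  assumes "strict_mono f"
  shows "occurrences p (map f \<pi>) = occurrences p \<pi>"
proof -
  have "map ((!) (map f \<pi>)) ps = map f (map ((!) \<pi>) ps)" if "set ps \<subseteq> {..<length \<pi>}" for ps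
    using that by auto
  then have "ps \<in> occurrences (w, adj) (map f \<pi>) \<longleftrightarrow> ps \<in> occurrences (w, adj) \<pi>" for ps w adj
    unfolding mem_occurrences_iff length_map
    using order_iso_map_strict_mono[OF assms] by metis
  then show ?thesis
    by (cases p) blast
qed

lemma occurrences_append_left:
  "{ps \<in> occurrences p (xs @ ys). set ps \<subseteq> {..<length xs}} = occurrences p xs"
proof -
  have "map ((!) (xs @ ys)) ps = map ((!) xs) ps" if "set ps \<subseteq> {..<length xs}" for ps
    using that by (auto simp: nth_append)
  moreover have "set ps \<subseteq> {..<length (xs @ ys)}" if "set ps \<subseteq> {..<length xs}" for ps
    using that by force
  ultimately have "ps \<in> occurrences (w, adj) (xs @ ys) \<and> set ps \<subseteq> {..<length xs} \<longleftrightarrow>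
      ps \<in> occurrences (w, adj) xs" for ps w adj
    unfolding mem_occurrences_iff by metis
  then show ?thesis
    by (cases p) blast
qed

lemma map_add_mem_occurrences_append_iff:
  assumes "wf_pattern p"
  shows "map ((+) (length xs)) ps \<in> occurrences p (xs @ ys) \<longleftrightarrow> ps \<in> occurrences p ys"
proof (cases p)
  case (Pair w adj)
  have "map ((!) (xs @ ys)) (map ((+) (length xs)) ps) = map ((!) ys) ps"
    by simp
  moreover have "map ((+) (length xs)) ps ! (a + 1) = map ((+) (length xs)) ps ! a + 1 \<longleftrightarrow>
      ps ! (a + 1) = ps ! a + 1" if "a \<in> adj" "length ps = length w" for a
    using that assms by (auto simp: wf_pattern_def Pair)
  ultimately show ?thesis
    unfolding Pair mem_occurrences_iff
    by (auto simp: sorted_wrt_map simp del: map_map dest: order_iso_imp_length_eq)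
qed

lemma occurrences_append_right:
  assumes "wf_pattern p"
  shows "{ps \<in> occurrences p (xs @ ys). set ps \<subseteq> {length xs..}} =
    map ((+) (length xs)) ` occurrences p ys"
    (is "?R = ?shift ` _")
proof -
  have "set ps \<subseteq> {length xs..} \<longleftrightarrow> ps \<in> range ?shift" for ps
  proof -
    have "set ps \<subseteq> {length xs..} \<longleftrightarrow> (\<forall>p\<in>set ps. \<exists>q. p = length xs + q)"
      by (auto simp: le_iff_add)
    then show ?thesis
      by (simp only: ex_map_conv[symmetric] image_iff bex_UNIV)
  qed
  then have "?R = ?shift ` {ps. ?shift ps \<in> occurrences p (xs @ ys)}"
    by (simp only:) blast
  then show ?thesis
    by (simp add: map_add_mem_occurrences_append_iff[OF assms])
qed

section \<open>Skew sums\<close>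

definition skew_indecomposable :: "'a::linorder list \<Rightarrow> bool" where
  "skew_indecomposable w \<longleftrightarrow> (\<forall>u v. w = u @ v \<longrightarrow> dominates u v \<longrightarrow> u = [] \<or> v = [])"

lemma skew_indecomposable_Cons_least:
  "\<forall>a\<in>set w. l \<le> a \<Longrightarrow> skew_indecomposable (l # w)"
  unfolding skew_indecomposable_def
proof (intro allI impI)
  fix u v
  assume "\<forall>a\<in>set w. l \<le> a" and "l # w = u @ v" and "dominates u v"
  then show "u = [] \<or> v = []"
    by (cases u; cases v) (auto simp: dominates_def)
qed

lemma skew_indecomposable_pat_132 [simp]: "skew_indecomposable (fst pat_132)"
  by (simp add: pat_132_def skew_indecomposable_Cons_least)

lemma skew_indecomposable_pat_inc [simp]: "skew_indecomposable (fst (pat_inc j))"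
proof (cases j)
  case (Suc i)
  then show ?thesis
    by (auto simp: pat_inc_def upt_conv_Cons simp del: upt_Suc
        intro!: skew_indecomposable_Cons_least)
qed (simp add: pat_inc_def skew_indecomposable_def)

lemma sorted_wrt_less_split:
  fixes ps :: "'a::linorder list"
  assumes "sorted_wrt (<) ps"
  obtains qs rs where "ps = qs @ rs" "set qs \<subseteq> {..<n}" "set rs \<subseteq> {n..}"
  using assms
proof (induction ps arbitrary: thesis)
  case (Cons p ps)
  show ?case
  proof (cases "p < n")
    case True
    from Cons obtain qs rs where "ps = qs @ rs" "set qs \<subseteq> {..<n}" "set rs \<subseteq> {n..}"
      by auto
    with True Cons.prems(1)[of "p # qs" rs] show ?thesis
      by simp
  next
    case False
    with Cons.prems(1)[of "[]" "p # ps"] Cons.prems(2) show ?thesis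
      by force
  qed
qed simp

lemma occurrence_append_dominates_cases:
  assumes ps: "ps \<in> occurrences p (xs @ ys)" and dominates: "dominates xs ys"
    and indecomposable: "skew_indecomposable (fst p)"
  shows "set ps \<subseteq> {..<length xs} \<or> set ps \<subseteq> {length xs..}"
proof -
  obtain w adj where p: "p = (w, adj)"
    by (cases p)
  have sorted: "sorted_wrt (<) ps" and bound: "set ps \<subseteq> {..<length (xs @ ys)}"
    and iso: "order_iso (map ((!) (xs @ ys)) ps) w"
    using ps unfolding p mem_occurrences_iff by blast+
  obtain qs rs where split: "ps = qs @ rs" "set qs \<subseteq> {..<length xs}" "set rs \<subseteq> {length xs..}"
    using sorted by (rule sorted_wrt_less_split)
  define u v where "u = take (length qs) w" and "v = drop (length qs) w"
  have w: "w = u @ v" and lengths: "length u = length qs" "length v = length rs"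
    using length_occurrence[OF ps] by (simp_all add: u_def v_def p split)
  have "(xs @ ys) ! i \<in> set xs" if "i \<in> set qs" for i
    using that split(2) by (auto simp: nth_append)
  moreover have "(xs @ ys) ! i \<in> set ys" if "i \<in> set rs" for i
  proof -
    have "length xs \<le> i" "i < length xs + length ys"
      using that split(1,3) bound by auto
    then show ?thesis
      by (simp add: nth_append)
  qed
  ultimately have "dominates (map ((!) (xs @ ys)) qs) (map ((!) (xs @ ys)) rs)"
    using dominates by (simp add: dominates_def)
  then have "dominates u v"
    using iso by (subst (asm) order_iso_append_dominates_iff) (simp_all add: w split(1) lengths)
  then have "u = [] \<or> v = []"
    using indecomposable w by (simp add: skew_indecomposable_def p)
  with lengths split show ?thesis
    by auto
qed

lemma occurrences_append_dominates:
  assumes "dominates xs ys" and "wf_pattern p" and "skew_indecomposable (fst p)"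
  shows "occurrences p (xs @ ys) =
    occurrences p xs \<union> map ((+) (length xs)) ` occurrences p ys"
  unfolding occurrences_append_left[of p xs ys, symmetric]
    occurrences_append_right[OF assms(2), symmetric]
  using occurrence_append_dominates_cases[OF _ assms(1,3)] by blast

lemma avoids_append_dominates_iff:
  assumes "dominates xs ys" and "wf_pattern p" and "skew_indecomposable (fst p)"
  shows "avoids (xs @ ys) p \<longleftrightarrow> avoids xs p \<and> avoids ys p"
  by (simp add: avoids_def occurrences_append_dominates[OF assms])

lemma occ_append_dominates:
  assumes "dominates xs ys" and "wf_pattern p" and "skew_indecomposable (fst p)"
    and nonempty: "fst p \<noteq> []"
  shows "occ p (xs @ ys) = occ p xs + occ p ys"
proof -
  let ?shift = "map ((+) (length xs))"
  have "occurrences p xs \<inter> ?shift ` occurrences p ys = {}"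
  proof -
    have "?shift ps \<notin> occurrences p xs" if "ps \<in> occurrences p ys" for ps
      using set_occurrence_subset[of "?shift ps" p xs] length_occurrence[OF that] nonempty
      by (cases ps) auto
    then show ?thesis
      by blast
  qed
  moreover have "card (?shift ` occurrences p ys) = card (occurrences p ys)"
    by (intro card_image inj_onI) (simp add: inj_map_eq_map)
  ultimately show ?thesis
    by (simp add: occ_def occurrences_append_dominates[OF assms(1-3)] card_Un_disjoint)
qed

section \<open>Appending a maximum\<close>

text \<open>
  The occurrences of \<open>w\<close> that a new maximum at the end of the word extends to occurrences of \<open>w @ [l]\<close>.
  Membership of \<open>length w - 1\<close> in \<open>adj\<close> means that no dash precedes the last letter \<open>l\<close>.
\<close>

definition extendable_occurrences ::
    "nat list \<Rightarrow> nat \<Rightarrow> nat set \<Rightarrow> nat list \<Rightarrow> nat list set" where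
  "extendable_occurrences w l adj \<pi> = {ps \<in> occurrences (w, adj - {length w - 1}) \<pi>.
     (\<forall>b\<in>set w. b < l) \<and> (length w - 1 \<in> adj \<longrightarrow> length \<pi> = last ps + 1)}"

lemma adjacencies_snoc_iff:
  assumes wf: "wf_pattern (w @ [l], adj)" and length: "length ps = length w"
  shows "(\<forall>a\<in>adj. (ps @ [p]) ! (a + 1) = (ps @ [p]) ! a + 1) \<longleftrightarrow>
    (\<forall>a\<in>adj - {length w - 1}. ps ! (a + 1) = ps ! a + 1) \<and>
    (length w - 1 \<in> adj \<longrightarrow> p = last ps + 1)"
proof -
  have "(ps @ [p]) ! (a + 1) = (ps @ [p]) ! a + 1 \<longleftrightarrow>
      (if a = length w - 1 then p = last ps + 1 else ps ! (a + 1) = ps ! a + 1)"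
    if "a \<in> adj" for a
  proof -
    have "a < length w"
      using wf that by (auto simp: wf_pattern_def)
    moreover from this have "ps \<noteq> []"
      using length by auto
    ultimately show ?thesis
      using length by (auto simp: nth_append last_conv_nth)
  qed
  then show ?thesis
    by auto
qed

lemma snoc_mem_occurrences_snoc_max_iff:
  assumes max: "\<forall>a\<in>set xs. a < m" and wf: "wf_pattern (w @ [l], adj)"
  shows "ps @ [length xs] \<in> occurrences (w @ [l], adj) (xs @ [m]) \<longleftrightarrow>
    ps \<in> extendable_occurrences w l adj xs"
proof (cases "length ps = length w \<and> set ps \<subseteq> {..<length xs}")
  case True
  then have length: "length ps = length w" and bound: "set ps \<subseteq> {..<length xs}"
    by auto
  have letters: "map ((!) (xs @ [m])) ps = map ((!) xs) ps"
    using bound by (auto simp: nth_append)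
  have "\<forall>a\<in>set (map ((!) xs) ps). a < m"
    using max bound by auto
  note iso = order_iso_snoc_max[OF this, of w l]
  show ?thesis
    using bound unfolding extendable_occurrences_def mem_Collect_eq mem_occurrences_iff
      adjacencies_snoc_iff[OF wf length]
    by (auto simp: sorted_wrt_append letters iso simp del: map_eq_conv)
next
  case False
  have "length ps = length w \<and> set ps \<subseteq> {..<length xs}"
    if "ps @ [length xs] \<in> occurrences (w @ [l], adj) (xs @ [m])"
    using that length_occurrence[OF that] by (auto simp: mem_occurrences_iff sorted_wrt_append)
  moreover have "length ps = length w \<and> set ps \<subseteq> {..<length xs}"
    if "ps \<in> extendable_occurrences w l adj xs"
    using that length_occurrence set_occurrence_subset
    unfolding extendable_occurrences_def by fastforce
  ultimately show ?thesis
    using False by blast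
qed

lemma occurrences_snoc_max:
  assumes max: "\<forall>a\<in>set xs. a < m" and wf: "wf_pattern (w @ [l], adj)"
  shows "occurrences (w @ [l], adj) (xs @ [m]) = occurrences (w @ [l], adj) xs \<union>
    (\<lambda>ps. ps @ [length xs]) ` extendable_occurrences w l adj xs"
    (is "?L = ?A \<union> ?snoc ` ?B")
proof -
  have "set ps \<subseteq> {..<length xs} \<or> ps \<in> range ?snoc" if ps: "ps \<in> ?L" for ps
  proof -
    from length_occurrence[OF ps] obtain qs q where "ps = qs @ [q]"
      by (cases ps rule: rev_cases) auto
    with ps show ?thesis
      by (cases "q = length xs") (force simp: mem_occurrences_iff sorted_wrt_append)+
  qed
  then have "?L = {ps \<in> ?L. set ps \<subseteq> {..<length xs}} \<union> {ps \<in> ?L. ps \<in> range ?snoc}"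
    by blast
  also have "{ps \<in> ?L. ps \<in> range ?snoc} = ?snoc ` ?B"
    using snoc_mem_occurrences_snoc_max_iff[OF assms] by blast
  finally show ?thesis
    unfolding occurrences_append_left .
qed

lemma occ_snoc_max:
  assumes max: "\<forall>a\<in>set xs. a < m" and wf: "wf_pattern (w @ [l], adj)"
  shows "occ (w @ [l], adj) (xs @ [m]) = occ (w @ [l], adj) xs +
    card (extendable_occurrences w l adj xs)"
    (is "_ = _ + card ?B")
proof -
  have "ps @ [length xs] \<notin> occurrences (w @ [l], adj) xs" for ps
    by (simp add: mem_occurrences_iff)
  then have "occurrences (w @ [l], adj) xs \<inter> (\<lambda>ps. ps @ [length xs]) ` ?B = {}"
    by blast
  moreover have "card ((\<lambda>ps. ps @ [length xs]) ` ?B) = card ?B"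
    by (intro card_image inj_onI) simp
  moreover have "finite ?B"
    by (simp add: extendable_occurrences_def)
  ultimately show ?thesis
    unfolding occ_def occurrences_snoc_max[OF assms] by (simp add: card_Un_disjoint)
qed

lemma avoids_132_snoc_max_iff:
  assumes "\<forall>a\<in>set xs. a < m"
  shows "avoids (xs @ [m]) pat_132 \<longleftrightarrow> avoids xs pat_132"
  using occurrences_snoc_max[OF assms, of "[1, 3]" 2 "{}"]
  by (simp add: avoids_def pat_132_def wf_pattern_def extendable_occurrences_def)

lemma pat_inc_Suc: "pat_inc (Suc j) = ([1..<Suc j] @ [Suc j], {0})"
  by (simp add: pat_inc_def)

lemma occ_pat_inc_Suc_snoc_max:
  assumes "\<forall>a\<in>set xs. a < m" and "j \<ge> 2"
  shows "occ (pat_inc (Suc j)) (xs @ [m]) = occ (pat_inc (Suc j)) xs + occ (pat_inc j) xs"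
proof -
  have "wf_pattern ([1..<Suc j] @ [Suc j], {0})"
    using wf_pattern_pat_inc[of "Suc j"] assms(2) unfolding pat_inc_Suc by simp
  from occ_snoc_max[OF assms(1) this] show ?thesis
    using assms(2) unfolding pat_inc_Suc
    by (simp add: occ_def pat_inc_def extendable_occurrences_def del: upt_Suc)
qed

lemma occ_pat_inc_2_snoc_max:
  assumes "\<forall>a\<in>set xs. a < m" and "xs \<noteq> []"
  shows "occ (pat_inc 2) (xs @ [m]) = occ (pat_inc 2) xs + 1"
proof -
  have pat: "pat_inc 2 = ([1] @ [2], {0})"
    by (simp add: pat_inc_def upt_rec)
  have "extendable_occurrences [1] 2 {0} xs = {[length xs - 1]}"
    using assms(2)
    by (auto simp: extendable_occurrences_def mem_occurrences_iff order_iso_def length_Suc_conv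
        neq_Nil_conv)
  then show ?thesis
    unfolding pat using occ_snoc_max[OF assms(1), of "[1]" 2 "{0}"]
    by (simp add: wf_pattern_def)
qed

section \<open>The weight of a permutation\<close>

definition weight :: "(nat \<Rightarrow> 'a::comm_monoid_mult) \<Rightarrow> nat list \<Rightarrow> 'a" where
  "weight x \<pi> = (\<Prod>j = 2..length \<pi>. x j ^ occ (pat_inc j) \<pi>)"

definition consecutive_products :: "(nat \<Rightarrow> 'a::times) \<Rightarrow> nat \<Rightarrow> 'a" where
  "consecutive_products x j = x j * x (j + 1)"

lemma weight_Nil [simp]: "weight x [] = 1"
  and weight_single [simp]: "weight x [m] = 1"
  by (simp_all add: weight_def)

lemma weight_map_strict_mono: "strict_mono f \<Longrightarrow> weight x (map f \<pi>) = weight x \<pi>"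
  by (simp add: weight_def occ_def occurrences_map_strict_mono)

lemma weight_eq_prod_upto:
  assumes "length \<pi> \<le> N"
  shows "weight x \<pi> = (\<Prod>j = 2..N. x j ^ occ (pat_inc j) \<pi>)"
proof -
  have "occ (pat_inc j) \<pi> = 0" if "length \<pi> < j" for j
    using that by (intro occ_eq_0) (simp add: pat_inc_def)
  then show ?thesis
    unfolding weight_def using assms by (intro prod.mono_neutral_left) auto
qed

lemma weight_append_dominates:
  assumes "dominates xs ys"
  shows "weight x (xs @ ys) = weight x xs * weight x ys"
proof -
  have "occ (pat_inc j) (xs @ ys) = occ (pat_inc j) xs + occ (pat_inc j) ys" if "j \<ge> 2" for j
    using assms that by (intro occ_append_dominates) (simp_all, simp add: pat_inc_def)
  then have "weight x (xs @ ys) = (\<Prod>j = 2..length (xs @ ys).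
      x j ^ occ (pat_inc j) xs * x j ^ occ (pat_inc j) ys)"
    unfolding weight_def by (intro prod.cong refl) (simp add: power_add)
  then show ?thesis
    by (simp add: prod.distrib weight_eq_prod_upto[of _ "length (xs @ ys)"])
qed

lemma weight_snoc_max:
  assumes max: "\<forall>a\<in>set xs. a < m" and "xs \<noteq> []"
  shows "weight x (xs @ [m]) = x 2 * weight (consecutive_products x) xs"
proof -
  define N where "N = length xs"
  have "N \<ge> 1"
    using assms(2) by (simp add: N_def Suc_le_eq)
  then have split: "(\<Prod>j = 2..Suc N. g j) = g 2 * (\<Prod>j = 2..N. g (Suc j))" for g :: "nat \<Rightarrow> 'a"
    using prod.atLeast_Suc_atMost[of 2 "Suc N" g] unfolding prod.shift_bounds_cl_Suc_ivl by simp
  have "weight x (xs @ [m]) = (\<Prod>j = 2..Suc N. x j ^ occ (pat_inc j) (xs @ [m]))"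
    by (rule weight_eq_prod_upto) (simp add: N_def)
  also have "\<dots> = x 2 ^ (occ (pat_inc 2) xs + 1) *
      (\<Prod>j = 2..N. x (Suc j) ^ (occ (pat_inc (Suc j)) xs + occ (pat_inc j) xs))"
    unfolding split
    by (simp add: occ_pat_inc_2_snoc_max[OF assms] occ_pat_inc_Suc_snoc_max[OF max])
  also have "\<dots> = x 2 * (\<Prod>j = 2..Suc N. x j ^ occ (pat_inc j) xs) *
      (\<Prod>j = 2..N. x (Suc j) ^ occ (pat_inc j) xs)"
    unfolding split by (simp add: power_add prod.distrib mult_ac)
  also have "(\<Prod>j = 2..Suc N. x j ^ occ (pat_inc j) xs) = (\<Prod>j = 2..N. x j ^ occ (pat_inc j) xs)"
    using weight_eq_prod_upto[of xs "Suc N" x] weight_eq_prod_upto[of xs N x] by (simp add: N_def)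
  finally show ?thesis
    by (simp add: weight_def N_def consecutive_products_def prod.distrib power_mult_distrib mult_ac)
qed

section \<open>The Dumont condition\<close>

definition dumont_step :: "nat \<Rightarrow> nat \<Rightarrow> bool" where
  "dumont_step a b \<longleftrightarrow> (if even a then b < a else a < b)"

lemma dumont_Nil [simp]: "dumont []"
  by (simp add: dumont_def)

lemma dumont_single [simp]: "dumont [a] \<longleftrightarrow> odd a"
  by (simp add: dumont_def)

lemma dumont_Cons_Cons: "dumont (a # b # \<pi>) \<longleftrightarrow> dumont_step a b \<and> dumont (b # \<pi>)"
  unfolding dumont_def by (subst length_Cons, subst All_less_Suc2) (auto simp: dumont_step_def)

lemma dumont_iff_successively:
  "dumont \<pi> \<longleftrightarrow> successively dumont_step \<pi> \<and> (\<pi> \<noteq> [] \<longrightarrow> odd (last \<pi>))"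
  by (induction dumont_step \<pi> rule: successively.induct) (auto simp: dumont_Cons_Cons)

lemma dumont_append_max_Cons_iff:
  assumes "\<forall>a\<in>set \<alpha>. a < m" and "\<forall>b\<in>set \<beta>. b < m"
  shows "dumont (\<alpha> @ m # \<beta>) \<longleftrightarrow> dumont \<alpha> \<and> dumont \<beta> \<and> (even m \<longleftrightarrow> \<beta> \<noteq> [])"
proof -
  have "dumont_step (last \<alpha>) m \<longleftrightarrow> odd (last \<alpha>)" if "\<alpha> \<noteq> []"
    using that assms(1) last_in_set[OF that] by (auto simp: dumont_step_def less_not_sym)
  moreover have "dumont_step m (hd \<beta>) \<longleftrightarrow> even m" if "\<beta> \<noteq> []"
    using that assms(2) hd_in_set[OF that] by (auto simp: dumont_step_def less_not_sym)
  ultimately show ?thesis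
    by (auto simp: dumont_iff_successively successively_append_iff successively_Cons)
qed

lemma dumont_map_add_even_iff: "even k \<Longrightarrow> dumont (map ((+) k) \<pi>) \<longleftrightarrow> dumont \<pi>"
  by (auto simp: dumont_iff_successively successively_map last_map dumont_step_def)

lemma dumont_least_odd:
  assumes "dumont \<pi>" and "c \<in> set \<pi>" and "\<forall>a\<in>set \<pi>. c \<le> a"
  shows "odd c"
proof -
  obtain i where "i < length \<pi>" "c = \<pi> ! i"
    using assms(2) by (auto simp: in_set_conv_nth)
  with assms(1,3) show ?thesis
    unfolding dumont_def by (meson leD nth_mem)
qed

section \<open>Decomposition of permutations avoiding 1-3-2 at the maximum\<close>

abbreviation perms :: "nat \<Rightarrow> nat list set" where
  "perms n \<equiv> permutations_of_set {1..n}"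

lemma length_perms: "\<pi> \<in> perms n \<Longrightarrow> length \<pi> = n"
  by (simp add: length_finite_permutations_of_set)

lemma set_perms: "\<pi> \<in> perms n \<Longrightarrow> set \<pi> = {1..n}"
  by (rule permutations_of_setD)

text \<open>In the notation of permutation patterns this is \<open>(\<alpha> \<oplus> 1) \<ominus> \<beta>\<close>.\<close>

definition max_join :: "nat list \<Rightarrow> nat list \<Rightarrow> nat list" where
  "max_join \<alpha> \<beta> = map ((+) (length \<beta>)) (\<alpha> @ [Suc (length \<alpha>)]) @ \<beta>"

lemma max_join_eq_append_Cons:
  "max_join \<alpha> \<beta> = map ((+) (length \<beta>)) \<alpha> @ Suc (length \<alpha> + length \<beta>) # \<beta>"
  by (simp add: max_join_def add.commute)

lemma strict_mono_add_left [simp]: "strict_mono ((+) (k :: 'a::linordered_semidom))"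
  by (simp add: strict_mono_def)

lemma set_map_add_perms: "\<alpha> \<in> perms a \<Longrightarrow> set (map ((+) k) \<alpha>) = {k + 1..k + a}"
  by (simp add: set_perms image_add_atLeastAtMost)

lemma max_join_mem_perms:
  assumes \<alpha>: "\<alpha> \<in> perms a" and \<beta>: "\<beta> \<in> perms k"
  shows "max_join \<alpha> \<beta> \<in> perms (Suc (a + k))"
proof (rule permutations_of_setI)
  show "set (max_join \<alpha> \<beta>) = {1..Suc (a + k)}"
    unfolding max_join_eq_append_Cons set_append list.set set_map_add_perms[OF \<alpha>] set_perms[OF \<beta>]
    using length_perms[OF \<alpha>] length_perms[OF \<beta>] by auto
  have "distinct \<alpha>" "distinct \<beta>"
    using \<alpha> \<beta> by (simp_all add: permutations_of_setD)
  then show "distinct (max_join \<alpha> \<beta>)"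
    using set_perms[OF \<alpha>] set_perms[OF \<beta>] length_perms[OF \<alpha>] length_perms[OF \<beta>]
    by (auto simp: max_join_eq_append_Cons distinct_map)
qed

lemma max_join_eq_iff:
  assumes "\<alpha> \<in> perms a" "\<beta> \<in> perms k" and "\<alpha>' \<in> perms a'" "\<beta>' \<in> perms k'"
  shows "max_join \<alpha> \<beta> = max_join \<alpha>' \<beta>' \<longleftrightarrow> \<alpha> = \<alpha>' \<and> \<beta> = \<beta>'"
proof
  assume eq: "max_join \<alpha> \<beta> = max_join \<alpha>' \<beta>'"
  define n where "n = Suc (a + k)"
  have "length (max_join \<alpha> \<beta>) = n" "length (max_join \<alpha>' \<beta>') = Suc (a' + k')"
    using assms by (simp_all add: max_join_def length_perms n_def)
  with eq have "Suc (a' + k') = n"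
    by simp
  then have "max_join \<alpha> \<beta> = map ((+) k) \<alpha> @ n # \<beta>" "max_join \<alpha>' \<beta>' = map ((+) k') \<alpha>' @ n # \<beta>'"
    using assms by (simp_all add: max_join_eq_append_Cons length_perms n_def)
  moreover have "n \<notin> set (map ((+) k) \<alpha>)" "n \<notin> set \<beta>"
    unfolding set_map_add_perms[OF assms(1)] set_perms[OF assms(2)] by (simp_all add: n_def)
  ultimately have "map ((+) k) \<alpha> = map ((+) k') \<alpha>'" "\<beta> = \<beta>'"
    using eq append_Cons_eq_iff by metis+
  moreover from this have "k = k'"
    using assms length_perms by blast
  ultimately show "\<alpha> = \<alpha>' \<and> \<beta> = \<beta>'"
    by (simp add: inj_map_eq_map)
qed simp

lemma dominates_max_join:
  assumes "\<alpha> \<in> perms a" and "\<beta> \<in> perms k"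
  shows "dominates (map ((+) (length \<beta>)) (\<alpha> @ [Suc (length \<alpha>)])) \<beta>"
  using assms by (auto simp: dominates_def length_perms set_perms)

lemma avoids_132_max_join_iff:
  assumes "\<alpha> \<in> perms a" and "\<beta> \<in> perms k"
  shows "avoids (max_join \<alpha> \<beta>) pat_132 \<longleftrightarrow> avoids \<alpha> pat_132 \<and> avoids \<beta> pat_132"
proof -
  have "avoids (max_join \<alpha> \<beta>) pat_132 \<longleftrightarrow>
      avoids (map ((+) (length \<beta>)) (\<alpha> @ [Suc (length \<alpha>)])) pat_132 \<and> avoids \<beta> pat_132"
    unfolding max_join_def using dominates_max_join[OF assms]
    by (rule avoids_append_dominates_iff) simp_all
  also have "avoids (map ((+) (length \<beta>)) (\<alpha> @ [Suc (length \<alpha>)])) pat_132 \<longleftrightarrow>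
      avoids (\<alpha> @ [Suc (length \<alpha>)]) pat_132"
    unfolding avoids_def by (subst occurrences_map_strict_mono) simp_all
  also have "\<dots> \<longleftrightarrow> avoids \<alpha> pat_132"
    using assms(1) by (intro avoids_132_snoc_max_iff) (simp add: set_perms length_perms)
  finally show ?thesis .
qed

lemma weight_max_join:
  assumes "\<alpha> \<in> perms a" and "\<beta> \<in> perms k"
  shows "weight x (max_join \<alpha> \<beta>) = weight x (\<alpha> @ [Suc a]) * weight x \<beta>"
  unfolding max_join_def weight_append_dominates[OF dominates_max_join[OF assms]]
  by (subst weight_map_strict_mono) (simp_all add: length_perms[OF assms(1)])

lemma order_iso_132_iff: "order_iso [a, b, c] [1, 3, 2 :: nat] \<longleftrightarrow> a < c \<and> c < b"
  by (auto simp: order_iso_def All_less_Suc numeral_3_eq_3)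

lemma avoids_132_imp_dominates:
  assumes avoids: "avoids (xs @ m # ys) pat_132" and distinct: "distinct (xs @ ys)"
    and max: "\<forall>b\<in>set ys. b < m"
  shows "dominates xs ys"
proof (rule ccontr)
  assume "\<not> dominates xs ys"
  then obtain a b where mem: "a \<in> set xs" "b \<in> set ys" and "\<not> b < a"
    by (auto simp: dominates_def)
  then have "a < b" "b < m"
    using distinct max by (auto simp: linorder_not_less order_le_less)
  moreover obtain i k where "i < length xs" "xs ! i = a" "k < length ys" "ys ! k = b"
    using mem by (auto simp: in_set_conv_nth)
  ultimately have "[i, length xs, length xs + Suc k] \<in> occurrences pat_132 (xs @ m # ys)"
    by (simp add: pat_132_def mem_occurrences_iff order_iso_132_iff nth_append del: One_nat_def)
  with avoids show False
    by (simp add: avoids_def)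
qed

lemma split_interval_initial_segment:
  fixes A B :: "nat set"
  assumes union: "A \<union> B = {1..n}" and less: "\<forall>a\<in>A. \<forall>b\<in>B. a < b"
  shows "A = {1..card A}" and "B = {card A + 1..n}"
proof -
  have bound: "A \<subseteq> {1..n}"
    using union by blast
  then have finite: "finite (insert 0 A)"
    by (simp add: finite_subset)
  define m where "m = Max (insert 0 A)"
  have A_eq: "A = {1..m}"
  proof (intro equalityI subsetI)
    fix a assume "a \<in> A"
    then have "1 \<le> a" "a \<le> m"
      using bound Max_ge[OF finite] unfolding m_def by (meson atLeastAtMost_iff insertCI subsetD)+
    then show "a \<in> {1..m}"
      by simp
  next
    fix c assume c: "c \<in> {1..m}"
    then have "m \<in> A"
      using Max_in[OF finite] unfolding m_def[symmetric] by auto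
    then have "m \<le> n" "c \<notin> B"
      using bound less c by (meson atLeastAtMost_iff leD subsetD)+
    with c union show "c \<in> A"
      by (metis UnE atLeastAtMost_iff order_trans)
  qed
  moreover have "B = {1..n} - A"
    using union less by blast
  ultimately have "B = {m + 1..n}"
    by auto
  with A_eq show "A = {1..card A}" "B = {card A + 1..n}"
    by simp_all
qed

lemma perms_Suc_split_max:
  assumes \<pi>: "\<pi> \<in> perms (Suc n)"
  obtains \<gamma> \<beta> where "\<pi> = \<gamma> @ Suc n # \<beta>" "distinct (\<gamma> @ \<beta>)" "set \<beta> \<union> set \<gamma> = {1..n}"
proof -
  have set: "set \<pi> = {1..Suc n}" and distinct: "distinct \<pi>"
    using \<pi> by (simp_all add: permutations_of_setD)
  then obtain \<gamma> \<beta> where split: "\<pi> = \<gamma> @ Suc n # \<beta>"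
    by (metis atLeastAtMost_iff le_add1 order_refl plus_1_eq_Suc split_list)
  have "set \<beta> \<union> set \<gamma> = {1..Suc n} - {Suc n}"
    unfolding set[symmetric] using distinct by (auto simp: split)
  also have "\<dots> = {1..n}"
    by auto
  finally show thesis
    using that split distinct by simp
qed

lemma avoids_132_max_join_cases:
  assumes \<pi>: "\<pi> \<in> perms (Suc n)" and avoids: "avoids \<pi> pat_132"
  obtains k \<alpha> \<beta> where "k \<le> n" "\<alpha> \<in> perms (n - k)" "\<beta> \<in> perms k" "\<pi> = max_join \<alpha> \<beta>"
proof -
  obtain \<gamma> \<beta> where split: "\<pi> = \<gamma> @ Suc n # \<beta>" and distinct: "distinct (\<gamma> @ \<beta>)"
    and union: "set \<beta> \<union> set \<gamma> = {1..n}"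
    using \<pi> by (rule perms_Suc_split_max)
  define k where "k = length \<beta>"
  have "k \<le> n"
    using length_perms[OF \<pi>] by (simp add: split k_def)
  have "\<forall>b\<in>set \<beta>. b < Suc n"
    using union by (metis UnI1 atLeastAtMost_iff le_imp_less_Suc)
  then have "dominates \<gamma> \<beta>"
    using avoids distinct unfolding split by (intro avoids_132_imp_dominates)
  moreover have "card (set \<beta>) = k"
    using distinct by (simp add: k_def distinct_card)
  ultimately have set_\<beta>: "set \<beta> = {1..k}" and set_\<gamma>: "set \<gamma> = {k + 1..n}"
    using split_interval_initial_segment[OF union] by (auto simp: dominates_def)
  have "\<gamma> \<in> permutations_of_set ((+) k ` {1..n - k})"
    using set_\<gamma> distinct \<open>k \<le> n\<close> by (simp add: permutations_of_setI)
  then obtain \<alpha> where \<alpha>: "\<alpha> \<in> perms (n - k)" "\<gamma> = map ((+) k) \<alpha>"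
    by (subst (asm) permutations_of_set_image_inj) auto
  have "\<beta> \<in> perms k"
    using set_\<beta> distinct by (simp add: permutations_of_setI)
  moreover have "\<pi> = max_join \<alpha> \<beta>"
    using \<alpha> length_perms[OF \<alpha>(1)] \<open>k \<le> n\<close>
    by (simp add: split max_join_eq_append_Cons k_def[symmetric])
  ultimately show thesis
    using that \<open>k \<le> n\<close> \<alpha>(1) by blast
qed

section \<open>Decomposition of Dumont permutations\<close>

definition dumont_sizes :: "nat \<Rightarrow> nat \<Rightarrow> bool" where
  "dumont_sizes a k \<longleftrightarrow> k = 0 \<and> even a \<or> a = 0 \<and> odd k \<or> odd a \<and> even k \<and> k \<noteq> 0"

lemma dumont_map_add_perms_iff:
  assumes "\<alpha> \<in> perms a"
  shows "dumont (map ((+) k) \<alpha>) \<longleftrightarrow> dumont \<alpha> \<and> (even k \<or> a = 0)"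
proof (cases "a = 0")
  case False
  have "even k" if "dumont (map ((+) k) \<alpha>)"
  proof -
    have "k + 1 \<in> set (map ((+) k) \<alpha>)" "\<forall>c\<in>set (map ((+) k) \<alpha>). k + 1 \<le> c"
      unfolding set_map_add_perms[OF assms] using False by simp_all
    then have "odd (k + 1)"
      by (rule dumont_least_odd[OF that])
    then show ?thesis
      by simp
  qed
  with False show ?thesis
    by (auto simp: dumont_map_add_even_iff)
qed (use assms in simp)

lemma dumont_max_join_iff:
  assumes \<alpha>: "\<alpha> \<in> perms a" and \<beta>: "\<beta> \<in> perms k"
  shows "dumont (max_join \<alpha> \<beta>) \<longleftrightarrow> dumont \<alpha> \<and> dumont \<beta> \<and> dumont_sizes a k"
proof -
  have "max_join \<alpha> \<beta> = map ((+) k) \<alpha> @ Suc (a + k) # \<beta>"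
    using length_perms[OF \<alpha>] length_perms[OF \<beta>] by (simp add: max_join_eq_append_Cons)
  moreover have "\<forall>c\<in>set (map ((+) k) \<alpha>). c < Suc (a + k)" "\<forall>b\<in>set \<beta>. b < Suc (a + k)"
    unfolding set_map_add_perms[OF \<alpha>] set_perms[OF \<beta>] by auto
  ultimately have "dumont (max_join \<alpha> \<beta>) \<longleftrightarrow>
      dumont (map ((+) k) \<alpha>) \<and> dumont \<beta> \<and> (even (Suc (a + k)) \<longleftrightarrow> \<beta> \<noteq> [])"
    by (simp only: dumont_append_max_Cons_iff)
  moreover have "\<beta> = [] \<longleftrightarrow> k = 0"
    using length_perms[OF \<beta>] by auto
  ultimately show ?thesis
    by (auto simp: dumont_map_add_perms_iff[OF \<alpha>] dumont_sizes_def)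
qed

definition dumont132_of_size :: "nat \<Rightarrow> nat list set" where
  "dumont132_of_size n = {\<pi> \<in> Dumont132. length \<pi> = n}"

lemma mem_dumont132_of_size_iff:
  "\<pi> \<in> dumont132_of_size n \<longleftrightarrow> \<pi> \<in> perms n \<and> dumont \<pi> \<and> avoids \<pi> pat_132"
  using length_perms by (auto simp: dumont132_of_size_def Dumont132_def)

lemma finite_dumont132_of_size [simp]: "finite (dumont132_of_size n)"
  by (rule finite_subset[of _ "perms n"]) (auto simp: mem_dumont132_of_size_iff)

lemma dumont132_of_size_0: "dumont132_of_size 0 = {[]}"
  by (auto simp: mem_dumont132_of_size_iff avoids_def pat_132_def mem_occurrences_iff order_iso_def)

lemma max_join_mem_dumont132_of_size_iff:
  assumes "\<alpha> \<in> perms a" and "\<beta> \<in> perms k"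
  shows "max_join \<alpha> \<beta> \<in> dumont132_of_size (Suc (a + k)) \<longleftrightarrow>
    \<alpha> \<in> dumont132_of_size a \<and> \<beta> \<in> dumont132_of_size k \<and> dumont_sizes a k"
  using assms max_join_mem_perms[OF assms] avoids_132_max_join_iff[OF assms]
    dumont_max_join_iff[OF assms]
  by (auto simp: mem_dumont132_of_size_iff)

definition dumont132_parts :: "nat \<Rightarrow> (nat \<times> nat list \<times> nat list) set" where
  "dumont132_parts n = (SIGMA k:{k. k \<le> n \<and> dumont_sizes (n - k) k}.
     dumont132_of_size (n - k) \<times> dumont132_of_size k)"

lemma dumont132_parts_perms:
  "(k, \<alpha>, \<beta>) \<in> dumont132_parts n \<Longrightarrow> \<alpha> \<in> perms (n - k)"
  "(k, \<alpha>, \<beta>) \<in> dumont132_parts n \<Longrightarrow> \<beta> \<in> perms k"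
  by (simp_all add: dumont132_parts_def mem_dumont132_of_size_iff)

lemma max_join_parts_eq_iff:
  assumes part: "(k, \<alpha>, \<beta>) \<in> dumont132_parts n" and part': "(k', \<alpha>', \<beta>') \<in> dumont132_parts n"
  shows "max_join \<alpha> \<beta> = max_join \<alpha>' \<beta>' \<longleftrightarrow> (k, \<alpha>, \<beta>) = (k', \<alpha>', \<beta>')"
  using max_join_eq_iff[OF dumont132_parts_perms[OF part] dumont132_parts_perms[OF part']]
    length_perms[OF dumont132_parts_perms(2)[OF part]]
    length_perms[OF dumont132_parts_perms(2)[OF part']]
  by auto

lemma bij_betw_max_join_dumont132_parts:
  "bij_betw (\<lambda>(k, \<alpha>, \<beta>). max_join \<alpha> \<beta>) (dumont132_parts n) (dumont132_of_size (Suc n))"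
    (is "bij_betw ?join ?P ?D")
proof (rule bij_betw_imageI)
  show "inj_on ?join ?P"
    using max_join_parts_eq_iff by (auto simp: inj_on_def)
  show "?join ` ?P = ?D"
  proof (intro equalityI subsetI)
    fix \<pi> assume "\<pi> \<in> ?join ` ?P"
    then obtain k \<alpha> \<beta> where part: "(k, \<alpha>, \<beta>) \<in> ?P" and "\<pi> = max_join \<alpha> \<beta>"
      by auto
    then show "\<pi> \<in> ?D"
      using max_join_mem_dumont132_of_size_iff[OF dumont132_parts_perms[OF part]]
      by (auto simp: dumont132_parts_def)
  next
    fix \<pi> assume \<pi>: "\<pi> \<in> ?D"
    then obtain k \<alpha> \<beta> where
      parts: "k \<le> n" "\<alpha> \<in> perms (n - k)" "\<beta> \<in> perms k" and join: "\<pi> = max_join \<alpha> \<beta>"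
      using avoids_132_max_join_cases unfolding mem_dumont132_of_size_iff by metis
    then have "(k, \<alpha>, \<beta>) \<in> ?P"
      using \<pi> max_join_mem_dumont132_of_size_iff[OF parts(2,3)] by (simp add: dumont132_parts_def)
    then show "\<pi> \<in> ?join ` ?P"
      by (rule rev_image_eqI) (simp add: join)
  qed
qed

section \<open>Recurrences for the generating functions\<close>

unbundle fps_syntax

definition dumont132_sum :: "(nat \<Rightarrow> 'a::comm_semiring_1) \<Rightarrow> nat \<Rightarrow> 'a" where
  "dumont132_sum x n = (\<Sum>\<pi>\<in>dumont132_of_size n. weight x \<pi>)"

lemma dumont132_sum_0 [simp]: "dumont132_sum x 0 = 1"
  by (simp add: dumont132_sum_def dumont132_of_size_0)

lemma sum_weight_snoc_max:
  "(\<Sum>\<alpha>\<in>dumont132_of_size a. weight x (\<alpha> @ [Suc a])) =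
    (if a = 0 then 1 else x 2 * dumont132_sum (consecutive_products x) a)"
proof (cases "a = 0")
  case False
  have "weight x (\<alpha> @ [Suc a]) = x 2 * weight (consecutive_products x) \<alpha>"
    if "\<alpha> \<in> dumont132_of_size a" for \<alpha>
  proof (rule weight_snoc_max)
    have "\<alpha> \<in> perms a"
      using that by (simp add: mem_dumont132_of_size_iff)
    then show "\<forall>c\<in>set \<alpha>. c < Suc a" "\<alpha> \<noteq> []"
      using False length_perms set_perms by fastforce+
  qed
  with False show ?thesis
    by (simp add: dumont132_sum_def sum_distrib_left)
qed (simp add: dumont132_of_size_0)

lemma dumont132_sum_Suc:
  "dumont132_sum x (Suc n) = (\<Sum>k | k \<le> n \<and> dumont_sizes (n - k) k.
     (if k = n then 1 else x 2 * dumont132_sum (consecutive_products x) (n - k)) *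
     dumont132_sum x k)"
proof -
  let ?K = "{k. k \<le> n \<and> dumont_sizes (n - k) k}" and ?D = dumont132_of_size
  let ?w = "\<lambda>k (\<alpha>, \<beta>). weight x (\<alpha> @ [Suc (n - k)]) * weight x \<beta>"
  have "dumont132_sum x (Suc n) = (\<Sum>(k, \<alpha>, \<beta>)\<in>dumont132_parts n. weight x (max_join \<alpha> \<beta>))"
    unfolding dumont132_sum_def
    using sum.reindex_bij_betw[OF bij_betw_max_join_dumont132_parts, of "weight x" n, symmetric]
    by (simp add: case_prod_unfold)
  also have "\<dots> = (\<Sum>(k, \<alpha>\<beta>)\<in>dumont132_parts n. ?w k \<alpha>\<beta>)"
    by (intro sum.cong refl) (auto intro: weight_max_join dumont132_parts_perms)
  also have "\<dots> = (\<Sum>k\<in>?K. \<Sum>\<alpha>\<beta>\<in>?D (n - k) \<times> ?D k. ?w k \<alpha>\<beta>)"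
    unfolding dumont132_parts_def by (rule sum.Sigma[symmetric]) simp_all
  also have "\<dots> = (\<Sum>k\<in>?K. (\<Sum>\<alpha>\<in>?D (n - k). weight x (\<alpha> @ [Suc (n - k)])) * dumont132_sum x k)"
    by (simp add: dumont132_sum_def sum_product sum.cartesian_product)
  finally show ?thesis
    unfolding sum_weight_snoc_max by (auto intro: sum.cong)
qed

lemma dumont132_sum_Suc_even:
  assumes "even n"
  shows "dumont132_sum x (Suc n) =
    (if n = 0 then 1 else x 2 * dumont132_sum (consecutive_products x) n)"
proof -
  have sizes: "{k. k \<le> n \<and> dumont_sizes (n - k) k} = {0}"
    using assms by (auto simp: dumont_sizes_def)
  show ?thesis
    unfolding dumont132_sum_Suc sizes by simp
qed

lemma dumont132_sum_Suc_odd: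
  assumes "odd n"
  shows "dumont132_sum x (Suc n) = dumont132_sum x n +
    x 2 * (\<Sum>k | k \<le> n \<and> even k \<and> k \<noteq> 0.
      dumont132_sum x k * dumont132_sum (consecutive_products x) (n - k))"
proof -
  let ?K = "{k. k \<le> n \<and> even k \<and> k \<noteq> 0}" and ?D = "dumont132_sum x"
  let ?D' = "dumont132_sum (consecutive_products x)"
  have "{k. k \<le> n \<and> dumont_sizes (n - k) k} = insert n ?K"
    using assms by (auto simp: dumont_sizes_def)
  moreover have "n \<notin> ?K"
    using assms by simp
  ultimately have "?D (Suc n) =
      ?D n + (\<Sum>k\<in>?K. (if k = n then 1 else x 2 * ?D' (n - k)) * ?D k)"
    by (simp add: dumont132_sum_Suc)
  also have "(\<Sum>k\<in>?K. (if k = n then 1 else x 2 * ?D' (n - k)) * ?D k) =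
      x 2 * (\<Sum>k\<in>?K. ?D k * ?D' (n - k))"
    unfolding sum_distrib_left using assms by (intro sum.cong) (auto simp: mult_ac)
  finally show ?thesis .
qed

lemma B_gf_nth: "B_gf x $ n = dumont132_sum x n"
  by (simp add: B_gf_def dumont132_sum_def dumont132_of_size_def weight_def)

context
  assumes two_neq_0: "(2 :: 'a::field) \<noteq> 0"
begin

lemma A2_nth: "A2 (x :: nat \<Rightarrow> 'a) $ n = (if even n then dumont132_sum x n else 0)"
  using two_neq_0 by (simp add: A2_def fps_compose_uminus' B_gf_nth field_simps)

lemma B2_nth: "B2 (x :: nat \<Rightarrow> 'a) $ n = (if odd n then dumont132_sum x n else 0)"
  using two_neq_0 by (simp add: B2_def fps_compose_uminus' B_gf_nth field_simps)

lemma B2_eq: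
  fixes x :: "nat \<Rightarrow> 'a"
  shows "B2 x = fps_X * (1 - fps_const (x 2) + fps_const (x 2) * A2 (consecutive_products x))"
proof (rule fps_ext)
  fix n
  show "B2 x $ n =
      (fps_X * (1 - fps_const (x 2) + fps_const (x 2) * A2 (consecutive_products x))) $ n"
    by (cases n) (simp_all add: B2_nth A2_nth dumont132_sum_Suc_even)
qed

lemma A2_recurrence:
  fixes x :: "nat \<Rightarrow> 'a"
  shows "A2 x =
    1 + fps_X * (B2 x + fps_const (x 2) * ((A2 x - 1) * B2 (consecutive_products x)))"
proof (rule fps_ext)
  fix n
  let ?y = "consecutive_products x"
  let ?rhs = "1 + fps_X * (B2 x + fps_const (x 2) * ((A2 x - 1) * B2 ?y))"
  show "A2 x $ n = ?rhs $ n"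
  proof (cases n)
    case 0
    then show ?thesis
      by (simp add: A2_nth)
  next
    case (Suc m)
    have "((A2 x - 1) * B2 ?y) $ m = (\<Sum>k\<le>m. if even k \<and> k \<noteq> 0 \<and> odd (m - k)
        then dumont132_sum x k * dumont132_sum ?y (m - k) else 0)"
      unfolding fps_mult_nth atMost_atLeast0
      by (intro sum.cong) (simp_all add: A2_nth B2_nth)
    also have "\<dots> = (if odd m
        then \<Sum>k | k \<le> m \<and> even k \<and> k \<noteq> 0. dumont132_sum x k * dumont132_sum ?y (m - k) else 0)"
      by (cases "odd m") (auto simp: sum.If_cases intro!: sum.neutral sum.mono_neutral_cong_right)
    finally show ?thesis
      by (simp add: Suc A2_nth B2_nth dumont132_sum_Suc_odd)
  qed
qed

lemma A2_eq_fraction: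
  fixes x :: "nat \<Rightarrow> 'a"
  shows "A2 x = 1 +
    fps_X^2 * (1 - fps_const (x 2) + fps_const (x 2) * A2 (consecutive_products x)) /
    (1 - fps_X^2 * fps_const (x 2) * (1 - fps_const (x 2 * x 3) +
      fps_const (x 2 * x 3) * A2 (consecutive_products (consecutive_products x))))"
    (is "_ = 1 + fps_X^2 * ?C / (1 - fps_X^2 * _ * ?E)")
proof -
  let ?D = "1 - fps_X^2 * fps_const (x 2) * ?E"
  have "B2 x = fps_X * ?C"
    by (rule B2_eq)
  moreover have "B2 (consecutive_products x) = fps_X * ?E"
    using B2_eq[of "consecutive_products x"]
    by (simp add: consecutive_products_def[of x 2])
  ultimately have "A2 x = 1 + fps_X * (fps_X * ?C + fps_const (x 2) * ((A2 x - 1) * (fps_X * ?E)))"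
    using A2_recurrence[of x] by simp
  then have "(A2 x - 1) * ?D = fps_X^2 * ?C"
    by (simp add: algebra_simps power2_eq_square)
  moreover have "?D $ 0 \<noteq> 0"
    by (simp add: mult.assoc)
  then have "?D \<noteq> 0"
    using fps_zero_nth by metis
  ultimately have "A2 x - 1 = fps_X^2 * ?C / ?D"
    by (metis nonzero_mult_div_cancel_right)
  then show ?thesis
    by (simp add: algebra_simps)
qed

end

lemma two_neq_0_fract: "(2 :: 'a::{idom, ring_char_0} fract) \<noteq> 0"
proof -
  have "(2 :: 'a fract) = Fract 2 1"
    using of_nat_fract[of 2, where 'a = 'a] by simp
  also have "\<dots> \<noteq> 0"
    by (simp add: Zero_fract_def eq_fract)
  finally show ?thesis .
qed

theorem theorem2p11:
  fixes x :: "nat \<Rightarrow> ratfun" and x1 x2 x3 :: "ratfun fps"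
  defines "x \<equiv> indet"
    and "x1 \<equiv> fps_X"
    and "x2 \<equiv> fps_const (x 2)"
    and "x3 \<equiv> fps_const (x 3)"
  shows "A2 x = 1 + (x1^2 * (1 - x2 + x2 * A2 (\<lambda>j. x j * x (j + 1))))
                  / (1 - x1^2 * x2 * (1 - x2 * x3
                       + x2 * x3 * A2 (\<lambda>j. x j * x (j + 1)^2 * x (j + 2))))
       \<and> B2 x = x1 - x1 * x2 + x1 * x2 * A2 (\<lambda>j. x j * x (j + 1))"
proof -
  have once: "consecutive_products x = (\<lambda>j. x j * x (j + 1))"
    and twice: "consecutive_products (consecutive_products x) =
      (\<lambda>j. x j * x (j + 1)^2 * x (j + 2))"
    by (simp_all add: fun_eq_iff consecutive_products_def power2_eq_square mult_ac)
  have x2x3: "fps_const (x 2 * x 3) = x2 * x3"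
    by (simp add: x2_def x3_def)
  have "A2 x = 1 + (x1^2 * (1 - x2 + x2 * A2 (\<lambda>j. x j * x (j + 1))))
      / (1 - x1^2 * x2 * (1 - x2 * x3 + x2 * x3 * A2 (\<lambda>j. x j * x (j + 1)^2 * x (j + 2))))"
    using A2_eq_fraction[OF two_neq_0_fract, of x]
    unfolding twice unfolding once x2x3 x1_def x2_def .
  moreover have "B2 x = x1 * (1 - x2 + x2 * A2 (\<lambda>j. x j * x (j + 1)))"
    using B2_eq[OF two_neq_0_fract, of x] unfolding once x1_def x2_def .
  ultimately show ?thesis
    by (simp only: right_diff_distrib distrib_left mult_1_right mult.assoc simp_thms)
qed

end
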